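(* Let $n\ge 1$ be an integer, let $\delta\in(0,n]$ and let $p\in[1,\infty)$. Then there exists an $\mathcal H_\infty^\delta$-capacity weight $w$ on $\mathbb R^n$ such that $w\in\mathcal A_{p,\delta}$ but $w\notin\mathcal A_{p,\beta}$ for every $\beta\in(0,\delta)$. (That is, the class of capacity Muckenhoupt weights $\mathcal A_{p,\delta}$ does not have the self-improving property with respect to the index $\delta$.)
   Context: For $\delta\in(0,n]$ and any subset $E\subset\mathbb R^n$, the Hausdorff content of $E$ is $$\mathcal H_\infty^\delta(E):=\inf\Big\{\sum_i [l(Q_i)]^\delta:\ E\subset\bigcup_i Q_i\Big\},$$ where the infimum is taken over all finite or countable coverings $\{Q_i\}_i$ of $E$ by cubes of $\mathbb R^n$, and $l(Q)$ denotes the edge length of the cube $Q$. A property holds $\mathcal H_\infty^\delta$-almost everywhere if the set where it fails has $\mathcal H_\infty^\delta$-content zero. For $E\subset\mathbb R^n$ and a non-negative function $f$ on $E$ (with values in $[0,\infty]$; no measurability is required), the Choquet integral is $$\int_E f(x)\,d\mathcal H_\infty^\delta:=\int_0^\infty \mathcal H_\infty^\delta(\{x\in E:\ f(x)>t\})\,dt.$$ $L^1_{\mathrm{loc}}(\mathbb R^n,\mathcal H_\infty^\delta)$ is the set of all functions $f$ such that $\int_K|f(x)|\,d\mathcal H_\infty^\delta<\infty$ for every compact set $K\subset\mathbb R^n$. A (non-negative) function $w$ on $\mathbb R^n$ is called an $\mathcal H_\infty^\delta$-capacity weight if $w\in L^1_{\mathrm{loc}}(\mathbb R^n,\mathcal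 H_\infty^\delta)$ and $w(x)\in(0,\infty)$ for $\mathcal H_\infty^\delta$-almost every $x\in\mathbb R^n$. The maximal operator associated with the Hausdorff content is $$\mathcal M_{\mathcal H_\infty^\delta}f(x):=\sup_{Q\ni x}\frac1{\mathcal H_\infty^\delta(Q)}\int_Q|f(y)|\,d\mathcal H_\infty^\delta,$$ the supremum being taken over all cubes $Q$ containing $x$. For $p\in[1,\infty)$ and $\delta\in(0,n]$, the class $\mathcal A_{p,\delta}$ of capacity Muckenhoupt weights is the set of all $\mathcal H_\infty^\delta$-capacity weights $w$ on $\mathbb R^n$ with $[w]_{\mathcal A_{p,\delta}}<\infty$, where, for $p\in(1,\infty)$, $$[w]_{\mathcal A_{p,\delta}}:=\sup_{Q\subset\mathbb R^n}\left\{\frac1{\mathcal H_\infty^\delta(Q)}\int_Q w(x)\,d\mathcal H_\infty^\delta\right\}\left\{\frac1{\mathcal H_\infty^\delta(Q)}\int_Q w(x)^{-\frac1{p-1}}\,d\mathcal H_\infty^\delta\right\}^{p-1},$$ with the supremum over all cubes $Q$ of $\mathbb R^n$ and the convention $0^{-1/(p-1)}=\infty$, and, for $p=1$, $$[w]_{\mathcal A_{1,\delta}}:=\inf\left\{K:\ \mathcal M_{\mathcal H_\infty^\delta}w\le K\,w\ \ \mathcal H_\infty^\delta\text{-almost everywhere}\right\}$$ (with $\inf\emptyset=\infty$). The class $\mathcal A_{p,\beta}$ is defined in the same way with $\beta$ in place of $\delta$ throughout. *)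

theory Defs
  imports "HOL-Analysis.Analysis"
begin

text \<open>
  Functions with values in $[0,\infty]$ are \<^typ>\<open>ennreal\<close>-valued, so $|f| = f$ throughout, and $L^1_{loc}$
  and the maximal operator appear without absolute values.
  Cubes are closed, with edges parallel to the coordinate axes and edge length \<open>l > 0\<close>.
  They are given by their lower corner and edge length, and a countable family of cubes is a
  countable set of such pairs. Restricting coverings to sets of pairs (no repetitions) does not
  affect the infimum.
\<close>

definition cube :: "real ^ 'n \<Rightarrow> real \<Rightarrow> (real ^ 'n) set" where
  "cube a l = cbox a (\<chi> i. a $ i + l)"

definition hcontent :: "real \<Rightarrow> (real ^ 'n) set \<Rightarrow> ennreal" where
  "hcontent d E =
     (INF C \<in> {C. countable C \<and> C \<subseteq> UNIV \<times> {0<..} \<and> E \<subseteq> (\<Union>(a, l)\<in>C. cube a l)}.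
        \<integral>\<^sup>+ (a, l). ennreal (l powr d) \<partial>count_space C)"

definition hcontent_ae :: "real \<Rightarrow> (real ^ 'n \<Rightarrow> bool) \<Rightarrow> bool" where
  "hcontent_ae d P \<longleftrightarrow> hcontent d {x. \<not> P x} = 0"

definition choquet :: "real \<Rightarrow> (real ^ 'n) set \<Rightarrow> (real ^ 'n \<Rightarrow> ennreal) \<Rightarrow> ennreal" where
  "choquet d E f = (\<integral>\<^sup>+ t\<in>{0..}. hcontent d {x \<in> E. f x > ennreal t} \<partial>lborel)"

definition L1_loc :: "real \<Rightarrow> (real ^ 'n \<Rightarrow> ennreal) set" where
  "L1_loc d = {f. \<forall>K. compact K \<longrightarrow> choquet d K f < \<infinity>}"

definition capacity_weight :: "real \<Rightarrow> (real ^ 'n \<Rightarrow> ennreal) \<Rightarrow> bool" where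
  "capacity_weight d w \<longleftrightarrow> w \<in> L1_loc d \<and> hcontent_ae d (\<lambda>x. 0 < w x \<and> w x < \<infinity>)"

definition cube_average :: "real \<Rightarrow> real ^ 'n \<Rightarrow> real \<Rightarrow> (real ^ 'n \<Rightarrow> ennreal) \<Rightarrow> ennreal" where
  "cube_average d a l f = 1 / hcontent d (cube a l) * choquet d (cube a l) f"

definition maximal_op :: "real \<Rightarrow> (real ^ 'n \<Rightarrow> ennreal) \<Rightarrow> real ^ 'n \<Rightarrow> ennreal" where
  "maximal_op d f x = (SUP (a, l) \<in> {(a, l). 0 < l \<and> x \<in> cube a l}. cube_average d a l f)"

text \<open>
  Real powers on $[0,\infty]$, with $0^s = \infty$ and $\infty^s = 0$ for \<open>s < 0\<close>, and
  $\infty^s = \infty$ for \<open>s > 0\<close>. The remaining values come from \<^const>\<open>powr\<close>, since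
  \<^term>\<open>enn2real \<infinity> = 0\<close> and \<^term>\<open>0 powr s = (0::real)\<close>. The exponent 0 is never used.
\<close>

definition ennpowr :: "ennreal \<Rightarrow> real \<Rightarrow> ennreal" where
  "ennpowr x s =
     (if (x = 0 \<and> s < 0) \<or> (x = \<infinity> \<and> s > 0) then \<infinity> else ennreal (enn2real x powr s))"

definition A1_const :: "real \<Rightarrow> (real ^ 'n \<Rightarrow> ennreal) \<Rightarrow> ennreal" where
  "A1_const d w =
     Inf {ennreal K | K. 0 \<le> K \<and> hcontent_ae d (\<lambda>x. maximal_op d w x \<le> ennreal K * w x)}"

text \<open>
  In the product below, \<^typ>\<open>ennreal\<close> would evaluate $0 \cdot \infty$ as 0, but for a capacity weight
  neither factor vanishes.
\<close>

definition Ap_const :: "real \<Rightarrow> real \<Rightarrow> (real ^ 'n \<Rightarrow> ennreal) \<Rightarrow> ennreal" where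
  "Ap_const p d w =
     (if p = 1 then A1_const d w
      else (SUP (a, l) \<in> UNIV \<times> {0<..}.
              cube_average d a l w *
              ennpowr (cube_average d a l (\<lambda>x. ennpowr (w x) (- 1 / (p - 1)))) (p - 1)))"

definition muckenhoupt :: "real \<Rightarrow> real \<Rightarrow> (real ^ 'n \<Rightarrow> ennreal) set" where
  "muckenhoupt p d = {w. capacity_weight d w \<and> Ap_const p d w < \<infinity>}"

end

(*
  The weight is 1 off a set E and infinite on E, where E has content zero in dimension delta but
  positive content in every dimension beta < delta. In dimension delta both averages in the
  Muckenhoupt condition are then at most 1, while in dimension beta the weight is not almost
  everywhere finite.

  E is a countable union of products of n copies of the Cantor set
  {sum_k b_k r^k : b_k = 0 or 1} with r < 1/2, which has dimension n log 2 / log (1/r); the ratios r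
  are chosen so that this dimension increases to delta. Covering by the 2^(kn) cubes of generation k
  gives content zero. Positivity holds because the map from sum_k b_k r^k to sum_k b_k 2^(-k-1) is
  Hoelder continuous in each coordinate and the image of the product fills a cube, so that a cheap
  covering would contradict the countable subadditivity of Lebesgue measure.
*)

theory Submission
  imports Defs
begin

section \<open>Binary digits and the Cantor set obtained by reading them in base
  \<open>1 / r\<close>\<close>

definition digit :: "real \<Rightarrow> nat \<Rightarrow> int" where
  "digit t k = \<lfloor>2 ^ Suc k * t\<rfloor> mod 2"

text \<open>\<open>digit t k\<close> is the coefficient of \<open>2 ^ -(k + 1)\<close> in the binary
  expansion of the fractional part of \<open>t\<close>, so \<open>spread (1/2)\<close> is twice the
  fractional part. Digits obtained from floors never end in an infinite run of ones; for
  \<open>r < 1/2\<close> the image of \<open>{0..<1}\<close> therefore misses countably many points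
  of the closed Cantor set.\<close>

definition spread :: "real \<Rightarrow> real \<Rightarrow> real" where
  "spread r t = (\<Sum>k. of_int (digit t k) * r ^ k)"

definition cantor_product :: "real \<Rightarrow> (real ^ 'n) set" where
  "cantor_product r = {x. \<forall>i. x $ i \<in> spread r ` {0..<1}}"

lemma digit_cases: "digit t k = 0 \<or> digit t k = 1"
  unfolding digit_def by linarith

lemma abs_digit_diff_le: "\<bar>real_of_int (digit s k) - of_int (digit t k)\<bar> \<le> 1"
  using digit_cases[of s k] digit_cases[of t k] by auto

lemma summable_digit:
  assumes "0 < r" "r < 1"
  shows "summable (\<lambda>k. real_of_int (digit t k) * r ^ k)"
proof (rule summable_comparison_test')
  show "summable (\<lambda>k. r ^ k)" using assms by (simp add: summable_geometric)
  show "norm (real_of_int (digit t k) * r ^ k) \<le> r ^ k" for k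
    using digit_cases[of t k] assms by auto
qed

lemma floor_double: "\<lfloor>2 ^ Suc k * t\<rfloor> = 2 * \<lfloor>2 ^ k * t\<rfloor> + digit t k"
proof -
  have "\<lfloor>2 ^ Suc k * t\<rfloor> div 2 = \<lfloor>2 ^ k * t\<rfloor>"
    using floor_divide_real_eq_div[of 2 "2 ^ Suc k * t"] by simp
  then show ?thesis
    unfolding digit_def by (metis mult_div_mod_eq)
qed

text \<open>Each digit is the last bit of the next floor (\<open>floor_double\<close>), so the
  integer part and the first \<open>k\<close> digits determine the floor recursively.\<close>

lemma floor_eq_of_digits:
  assumes "\<lfloor>s\<rfloor> = \<lfloor>t\<rfloor>" "\<And>j. j < k \<Longrightarrow> digit s j = digit t j"
  shows "\<lfloor>2 ^ k * s\<rfloor> = \<lfloor>2 ^ k * t\<rfloor>"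
  using assms(2)
proof (induction k)
  case 0
  then show ?case using assms(1) by simp
next
  case (Suc k)
  then show ?case by (simp only: floor_double lessI less_SucI)
qed

lemma dist_le_of_digits:
  assumes "\<lfloor>s\<rfloor> = \<lfloor>t\<rfloor>" "\<And>j. j < k \<Longrightarrow> digit s j = digit t j"
  shows "\<bar>s - t\<bar> \<le> (1/2) ^ k"
proof -
  have "\<lfloor>2 ^ k * s\<rfloor> = \<lfloor>2 ^ k * t\<rfloor>"
    using assms by (rule floor_eq_of_digits)
  then have "\<bar>2 ^ k * s - 2 ^ k * t\<bar> \<le> 1"
    by linarith
  then have "2 ^ k * \<bar>s - t\<bar> \<le> 1"
    by (simp add: abs_mult flip: right_diff_distrib)
  then show ?thesis
    by (simp add: field_simps power_divide)
qed

text \<open>The first differing digit contributes exactly \<open>r ^ k\<close>, while all later ones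
  together contribute at most \<open>r ^ Suc k / (1 - r)\<close>. This is smaller than
  \<open>r ^ k\<close> because \<open>r < 1/2\<close>, and the lower bound is the difference of the
  two.\<close>

lemma spread_diff_ge:
  assumes r: "0 < r" "r < 1/2"
    and eq: "\<And>j. j < k \<Longrightarrow> digit s j = digit t j" and neq: "digit s k \<noteq> digit t k"
  shows "(1 - 2 * r) / (1 - r) * r ^ k \<le> \<bar>spread r s - spread r t\<bar>"
proof -
  define d where "d j = real_of_int (digit s j) - of_int (digit t j)" for j
  have sm: "summable (\<lambda>k. d k * r ^ k)"
    using summable_diff[OF summable_digit[of r s] summable_digit[of r t]] r
    by (simp add: d_def left_diff_distrib)
  have "spread r s - spread r t = (\<Sum>j. d j * r ^ j)"
    unfolding spread_def d_def
    by (subst suminf_diff) (use r summable_digit in \<open>auto simp: left_diff_distrib\<close>)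
  also have "\<dots> = (\<Sum>j. d (j + Suc k) * r ^ (j + Suc k)) + (\<Sum>j<Suc k. d j * r ^ j)"
    by (rule suminf_split_initial_segment[OF sm])
  also have "(\<Sum>j<Suc k. d j * r ^ j) = d k * r ^ k"
    using eq by (simp add: d_def)
  finally have diff: "spread r s - spread r t
      = (\<Sum>j. d (j + Suc k) * r ^ (j + Suc k)) + d k * r ^ k" .
  have sg: "(\<lambda>j. r ^ (j + Suc k)) sums (r ^ Suc k * (1 / (1 - r)))"
    using sums_mult[OF geometric_sums[of r], of "r ^ Suc k"] r
    by (simp add: power_add mult_ac)
  have nd: "norm (d (j + Suc k) * r ^ (j + Suc k)) \<le> r ^ (j + Suc k)" for j
    using mult_right_mono[OF abs_digit_diff_le[of s "j + Suc k" t], of "r ^ (j + Suc k)"] r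
    by (simp add: abs_mult d_def)
  have "norm (\<Sum>j. d (j + Suc k) * r ^ (j + Suc k)) \<le> (\<Sum>j. r ^ (j + Suc k))"
    by (rule norm_suminf_le[OF nd sums_summable[OF sg]])
  then have tail: "\<bar>\<Sum>j. d (j + Suc k) * r ^ (j + Suc k)\<bar> \<le> r ^ Suc k * (1 / (1 - r))"
    using sg by (simp add: sums_iff)
  have "\<bar>d k\<bar> = 1"
    using neq digit_cases[of s k] digit_cases[of t k] by (auto simp: d_def)
  then have "\<bar>d k * r ^ k\<bar> = r ^ k" using r by (simp add: abs_mult)
  moreover have "(1 - 2 * r) / (1 - r) * r ^ k = r ^ k - r ^ Suc k * (1 / (1 - r))"
    using r by (simp add: field_simps)
  ultimately show ?thesis
    using diff tail by linarith
qed

text \<open>If the digits first differ at \<open>k\<close>, then \<open>s\<close> and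
  \<open>t\<close> are within \<open>(1/2) ^ k \<le> (r ^ k) powr \<gamma>\<close>, and
  \<open>spread_diff_ge\<close> bounds \<open>r ^ k\<close> by the gap between the spreads. The
  floors must agree because digits do not see the integer part.\<close>

lemma spread_inverse_holder:
  assumes r: "0 < r" "r < 1/2" and \<gamma>: "0 \<le> \<gamma>" "1/2 \<le> r powr \<gamma>" and fl: "\<lfloor>s\<rfloor> = \<lfloor>t\<rfloor>"
  shows "\<bar>s - t\<bar> \<le> ((1 - r) / (1 - 2 * r) * \<bar>spread r s - spread r t\<bar>) powr \<gamma>"
proof (cases "\<exists>k. digit s k \<noteq> digit t k")
  case True
  define k where "k = (LEAST k. digit s k \<noteq> digit t k)"
  have neq: "digit s k \<noteq> digit t k"
    unfolding k_def using True by (rule LeastI_ex)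
  have eq: "digit s j = digit t j" if "j < k" for j
    using not_less_Least[OF that[unfolded k_def]] by simp
  have "\<bar>s - t\<bar> \<le> (1/2) ^ k"
    using fl eq by (rule dist_le_of_digits)
  also have "\<dots> \<le> (r powr \<gamma>) ^ k"
    using \<gamma> by (intro power_mono) auto
  also have "\<dots> = (r ^ k) powr \<gamma>"
    using r by (simp add: powr_powr mult.commute flip: powr_realpow)
  also have "\<dots> \<le> ((1 - r) / (1 - 2 * r) * \<bar>spread r s - spread r t\<bar>) powr \<gamma>"
  proof (rule powr_mono2)
    show "r ^ k \<le> (1 - r) / (1 - 2 * r) * \<bar>spread r s - spread r t\<bar>"
      using spread_diff_ge[OF r eq neq] r by (simp add: field_simps)
  qed (use r \<gamma> in auto)
  finally show ?thesis .
next
  case False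
  then have "\<bar>s - t\<bar> \<le> (1/2) ^ k" for k
    using fl by (intro dist_le_of_digits) auto
  moreover have "(\<lambda>k. (1/2::real) ^ k) \<longlonglongrightarrow> 0"
    by (rule LIMSEQ_power_zero) simp
  ultimately have "\<bar>s - t\<bar> \<le> 0"
    by (intro LIMSEQ_le_const) auto
  then show ?thesis by simp
qed

text \<open>The tail of the series lies between 0 and a geometric tail. The prefix sums are thus the
  left ends of the intervals of generation \<open>k\<close>, of length
  \<open>r ^ k / (1 - r)\<close>.\<close>

lemma spread_prefix_bounds:
  assumes "0 < r" "r < 1"
  shows "(\<Sum>j<k. of_int (digit t j) * r ^ j) \<le> spread r t"
    and "spread r t \<le> (\<Sum>j<k. of_int (digit t j) * r ^ j) + r ^ k / (1 - r)"
proof -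
  let ?f = "\<lambda>j. real_of_int (digit t j) * r ^ j"
  have sm: "summable (\<lambda>j. ?f (j + k))"
    using summable_ignore_initial_segment[OF summable_digit[OF assms]] .
  have f: "0 \<le> ?f j" "?f j \<le> r ^ j" for j
    using digit_cases[of t j] assms by auto
  have sg: "(\<lambda>j. r ^ (j + k)) sums (r ^ k / (1 - r))"
    using sums_mult[OF geometric_sums[of r], of "r ^ k"] assms
    by (simp add: power_add mult_ac)
  have split: "spread r t = (\<Sum>j. ?f (j + k)) + (\<Sum>j<k. ?f j)"
    unfolding spread_def by (rule suminf_split_initial_segment[OF summable_digit[OF assms]])
  have "0 \<le> (\<Sum>j. ?f (j + k))"
    by (rule suminf_nonneg[OF sm f(1)])
  then show "(\<Sum>j<k. ?f j) \<le> spread r t"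
    using split by simp
  have "(\<Sum>j. ?f (j + k)) \<le> (\<Sum>j. r ^ (j + k))"
    by (rule suminf_le[OF f(2) sm sums_summable[OF sg]])
  then show "spread r t \<le> (\<Sum>j<k. ?f j) + r ^ k / (1 - r)"
    using split sums_unique[OF sg] by simp
qed

text \<open>The next digit adds either 0 or \<open>r ^ k\<close>, so the set of prefix sums at most
  doubles with each generation.\<close>

lemma card_prefix_sums_le:
  "finite (range (\<lambda>t. \<Sum>j<k. real_of_int (digit t j) * r ^ j)) \<and>
   card (range (\<lambda>t. \<Sum>j<k. real_of_int (digit t j) * r ^ j)) \<le> 2 ^ k"
proof (induction k)
  case 0
  then show ?case by (simp add: image_constant_conv)
next
  case (Suc k)
  let ?S = "\<lambda>k. range (\<lambda>t. \<Sum>j<k. real_of_int (digit t j) * r ^ j)"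
  have sub: "?S (Suc k) \<subseteq> ?S k \<union> (\<lambda>x. x + r ^ k) ` ?S k"
  proof
    fix x assume "x \<in> ?S (Suc k)"
    then obtain t where "x = (\<Sum>j<Suc k. real_of_int (digit t j) * r ^ j)" by blast
    then show "x \<in> ?S k \<union> (\<lambda>x. x + r ^ k) ` ?S k"
      using digit_cases[of t k] by auto
  qed
  have "card (?S (Suc k)) \<le> card (?S k \<union> (\<lambda>x. x + r ^ k) ` ?S k)"
    using sub Suc.IH by (intro card_mono) auto
  also have "\<dots> \<le> card (?S k) + card ((\<lambda>x. x + r ^ k) ` ?S k)"
    by (rule card_Un_le)
  also have "\<dots> \<le> card (?S k) + card (?S k)"
    using Suc.IH by (intro add_left_mono card_image_le) simp
  also have "\<dots> \<le> 2 ^ Suc k"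
    using Suc.IH by simp
  finally show ?case
    using finite_subset[OF sub] Suc.IH by simp
qed

lemma card_vec_components:
  fixes S :: "'a set"
  assumes "finite S"
  shows "finite {a :: 'a ^ 'n. \<forall>i. a $ i \<in> S}"
    and "card {a :: 'a ^ 'n. \<forall>i. a $ i \<in> S} = card S ^ CARD('n)"
proof -
  have eq: "{a :: 'a ^ 'n. \<forall>i. a $ i \<in> S} = vec_lambda ` (\<Pi>\<^sub>E i\<in>UNIV. S)"
  proof (intro equalityI subsetI)
    fix a :: "'a ^ 'n" assume "a \<in> {a. \<forall>i. a $ i \<in> S}"
    then have "a = vec_lambda (($) a)" "($) a \<in> (\<Pi>\<^sub>E i\<in>UNIV. S)" by auto
    then show "a \<in> vec_lambda ` (\<Pi>\<^sub>E i\<in>UNIV. S)" by blast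
  qed auto
  have "inj_on vec_lambda (\<Pi>\<^sub>E i\<in>(UNIV :: 'n set). S)"
    by (auto simp: inj_on_def vec_lambda_inject)
  then show "card {a :: 'a ^ 'n. \<forall>i. a $ i \<in> S} = card S ^ CARD('n)"
    unfolding eq by (simp add: card_image card_PiE)
  show "finite {a :: 'a ^ 'n. \<forall>i. a $ i \<in> S}"
    unfolding eq using assms by (intro finite_imageI finite_PiE) auto
qed

section \<open>Cubes and Lebesgue measure\<close>

lemma mem_cube: "x \<in> cube a l \<longleftrightarrow> (\<forall>i. a $ i \<le> x $ i \<and> x $ i \<le> a $ i + l)"
  by (simp add: cube_def mem_box_cart)

lemma sets_cube [measurable]: "cube a l \<in> sets borel"
  by (simp add: cube_def)

lemma emeasure_cube:
  fixes a :: "real ^ 'n"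
  assumes "0 \<le> l"
  shows "emeasure lborel (cube a l) = ennreal (l ^ CARD('n))"
proof -
  have "cube a l \<noteq> {}"
    using assms mem_cube[of a a l] by auto
  then have "measure lborel (cube a l) = l ^ CARD('n)"
    unfolding cube_def by (simp add: content_cbox_cart)
  moreover have "emeasure lborel (cube a l) = ennreal (measure lborel (cube a l))"
    unfolding cube_def
    by (intro emeasure_eq_ennreal_measure) (metis emeasure_lborel_cbox_finite infinity_ennreal_def less_irrefl)
  ultimately show ?thesis by simp
qed

text \<open>Countable subadditivity with the sum written as a \<open>count_space\<close> integral,
  the form in which \<open>hcontent\<close> states the cost of a covering. The indicator of the
  union is at most the sum of the indicators; then the two integrals are exchanged.\<close>

lemma emeasure_UN_le_nn_integral:
  assumes "countable I" "\<And>i. i \<in> I \<Longrightarrow> A i \<in> sets M"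
  shows "emeasure M (\<Union>i\<in>I. A i) \<le> (\<integral>\<^sup>+ i. emeasure M (A i) \<partial>count_space I)"
proof -
  have "emeasure M (\<Union>i\<in>I. A i) = (\<integral>\<^sup>+ x. indicator (\<Union>i\<in>I. A i) x \<partial>M)"
    using assms by (intro nn_integral_indicator[symmetric] sets.countable_UN') auto
  also have "\<dots> \<le> (\<integral>\<^sup>+ x. (\<integral>\<^sup>+ i. indicator (A i) x \<partial>count_space I) \<partial>M)"
  proof (rule nn_integral_mono)
    fix x
    show "indicator (\<Union>i\<in>I. A i) x \<le> (\<integral>\<^sup>+ i. (indicator (A i) x :: ennreal) \<partial>count_space I)"
    proof (cases "x \<in> (\<Union>i\<in>I. A i)")
      case True
      then obtain i where "i \<in> I" "x \<in> A i" by blast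
      then show ?thesis
        using nn_integral_ge_point[of i I "\<lambda>i. indicator (A i) x"] True by simp
    qed simp
  qed
  also have "\<dots> = (\<integral>\<^sup>+ i. (\<integral>\<^sup>+ x. indicator (A i) x \<partial>M) \<partial>count_space I)"
    using assms by (intro nn_integral_count_space_nn_integral) auto
  also have "\<dots> = (\<integral>\<^sup>+ i. emeasure M (A i) \<partial>count_space I)"
    using assms by (intro nn_integral_cong) simp
  finally show ?thesis .
qed

section \<open>Basic properties of the Hausdorff content\<close>

lemma hcontent_le:
  assumes "countable C" "C \<subseteq> UNIV \<times> {0<..}" "E \<subseteq> (\<Union>(a, l)\<in>C. cube a l)"
  shows "hcontent d E \<le> (\<integral>\<^sup>+ (a, l). ennreal (l powr d) \<partial>count_space C)"
  unfolding hcontent_def using assms by (intro INF_lower) auto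

lemma hcontent_mono: "E \<subseteq> F \<Longrightarrow> hcontent d E \<le> hcontent d F"
  unfolding hcontent_def by (intro INF_superset_mono) auto

lemma hcontent_compact_finite:
  fixes K :: "(real ^ 'n) set"
  assumes "compact K"
  shows "hcontent d K < \<infinity>"
proof -
  obtain a where a: "K \<subseteq> cbox (- a) a"
    using bounded_subset_cbox_symmetric compact_imp_bounded[OF assms] by blast
  \<comment> \<open>Edge \<open>2 * norm a\<close> already reaches from \<open>- a\<close> past
    \<open>a\<close> in every coordinate; the added 1 keeps the edge positive when
    \<open>a = 0\<close>.\<close>
  define l where "l = 1 + 2 * norm a"
  have "K \<subseteq> cube (- a) l"
  proof
    fix x assume "x \<in> K"
    then have x: "\<forall>i. - a $ i \<le> x $ i \<and> x $ i \<le> a $ i"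
      using a by (auto simp: mem_box_cart)
    have "a $ i \<le> norm a" for i
      using component_le_norm_cart[of a i] by simp
    then show "x \<in> cube (- a) l"
      unfolding mem_cube l_def using x by (smt (verit) vector_uminus_component)
  qed
  moreover have "0 < l"
    unfolding l_def using norm_ge_zero[of a] by linarith
  ultimately have "hcontent d K \<le> (\<integral>\<^sup>+ (a, l). ennreal (l powr d) \<partial>count_space {(- a, l)})"
    by (intro hcontent_le) auto
  also have "\<dots> < \<infinity>"
    by (simp add: nn_integral_count_space_finite)
  finally show ?thesis .
qed

text \<open>Cover the \<open>m\<close>-th set at cost below \<open>e * (1/2) ^ Suc m\<close> and
  take the union of the coverings; the costs add up to at most \<open>e\<close>.\<close>

lemma hcontent_null_UN:
  assumes "\<And>m :: nat. hcontent d (E m) = 0"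
  shows "hcontent d (\<Union>m. E m) = 0"
proof -
  have "hcontent d (\<Union>m. E m) \<le> 0 + ennreal e" if "0 < e" for e
  proof -
    have "\<exists>C. countable C \<and> C \<subseteq> UNIV \<times> {0<..} \<and> E m \<subseteq> (\<Union>(a, l)\<in>C. cube a l) \<and>
      (\<integral>\<^sup>+ (a, l). ennreal (l powr d) \<partial>count_space C) < ennreal (e * (1/2) ^ Suc m)" for m
    proof -
      have "hcontent d (E m) < ennreal (e * (1/2) ^ Suc m)"
        using assms that by simp
      then show ?thesis
        unfolding hcontent_def by (auto simp: INF_less_iff)
    qed
    then obtain C where C: "\<And>m. countable (C m)" "\<And>m. C m \<subseteq> UNIV \<times> {0<..}"
      "\<And>m. E m \<subseteq> (\<Union>(a, l)\<in>C m. cube a l)"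
      "\<And>m. (\<integral>\<^sup>+ (a, l). ennreal (l powr d) \<partial>count_space (C m)) < ennreal (e * (1/2) ^ Suc m)"
      by metis
    \<comment> \<open>The cost of a covering becomes the measure \<open>N\<close> of its set of
      pairs, so that subadditivity of a measure handles pairs shared by several coverings.\<close>
    define N where "N = density (count_space UNIV) (\<lambda>(a :: real ^ 'a, l). ennreal (l powr d))"
    have N: "emeasure N X = (\<integral>\<^sup>+ (a, l). ennreal (l powr d) \<partial>count_space X)" for X
      unfolding N_def by (simp add: emeasure_density nn_integral_count_space_indicator)
    have "hcontent d (\<Union>m. E m) \<le> emeasure N (\<Union>m. C m)"
      unfolding N using C(1-3) by (intro hcontent_le) (auto, fastforce)
    also have "\<dots> \<le> (\<Sum>m. emeasure N (C m))"
      by (intro emeasure_subadditive_countably) (auto simp: N_def)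
    also have "\<dots> \<le> (\<Sum>m. ennreal (e * (1/2) ^ Suc m))"
      using C(4) by (intro suminf_le) (auto simp: N intro: less_imp_le)
    also have "\<dots> = ennreal e"
      using sums_mult[OF power_half_series, of e] that
      by (intro suminf_ennreal_eq) auto
    finally show ?thesis by simp
  qed
  then show ?thesis
    using ennreal_le_epsilon[of 0 "hcontent d (\<Union>m. E m)"] by simp
qed

section \<open>Content of the Cantor products\<close>

lemma hcontent_cantor_product_null:
  assumes r: "0 < r" "r < 1" and small: "2 ^ CARD('n) * r powr d < 1"
  shows "hcontent d (cantor_product r :: (real ^ 'n) set) = 0"
proof -
  \<comment> \<open>Each generation multiplies the number of cubes by at most
    \<open>2 ^ CARD('n)\<close> and the edge by \<open>r\<close>, so \<open>q\<close> bounds the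
    growth of the cost per generation. As \<open>q < 1\<close>, the cost tends to 0.\<close>
  define q where "q = 2 ^ CARD('n) * r powr d"
  have "hcontent d (cantor_product r :: (real ^ 'n) set) \<le> ennreal (q ^ k * (1 / (1 - r)) powr d)" for k
  proof -
    define S where "S = range (\<lambda>t. \<Sum>j<k. real_of_int (digit t j) * r ^ j)"
    define V where "V = {a :: real ^ 'n. \<forall>i. a $ i \<in> S}"
    define L where "L = r ^ k / (1 - r)"
    have S: "finite S" "card S \<le> 2 ^ k"
      unfolding S_def using card_prefix_sums_le by auto
    have V: "finite V" "card V = card S ^ CARD('n)"
      unfolding V_def using card_vec_components[OF S(1)] by auto
    have L: "0 < L" using r by (simp add: L_def)
    have cover: "cantor_product r \<subseteq> (\<Union>(a, l)\<in>V \<times> {L}. cube a l)"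
    proof
      fix x :: "real ^ 'n" assume "x \<in> cantor_product r"
      then have "\<exists>t. x $ i = spread r t" for i
        unfolding cantor_product_def by blast
      then obtain t where t: "\<And>i. x $ i = spread r (t i)" by metis
      let ?a = "\<chi> i. \<Sum>j<k. real_of_int (digit (t i) j) * r ^ j"
      have "?a \<in> V" unfolding V_def S_def by auto
      moreover have "x \<in> cube ?a L"
        unfolding mem_cube L_def using spread_prefix_bounds[OF r] t by simp
      ultimately show "x \<in> (\<Union>(a, l)\<in>V \<times> {L}. cube a l)" by blast
    qed
    have "hcontent d (cantor_product r :: (real ^ 'n) set)
        \<le> (\<integral>\<^sup>+ (a, l). ennreal (l powr d) \<partial>count_space (V \<times> {L}))"
      using V(1) L cover by (intro hcontent_le) (auto intro: countable_finite)
    also have "\<dots> = (\<Sum>(a, l)\<in>V \<times> {L}. ennreal (l powr d))"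
      using V(1) by (intro nn_integral_count_space_finite) auto
    also have "\<dots> = (\<Sum>x\<in>V \<times> {L}. ennreal (L powr d))"
      by (intro sum.cong) auto
    also have "\<dots> = ennreal (real (card V) * L powr d)"
      by (simp add: card_cartesian_product ennreal_mult ennreal_of_nat_eq_real_of_nat)
    also have "\<dots> \<le> ennreal ((2 ^ k) ^ CARD('n) * L powr d)"
    proof (intro ennreal_leI mult_right_mono)
      show "real (card V) \<le> (2 ^ k) ^ CARD('n)"
        unfolding V(2) using power_mono[OF S(2), of "CARD('n)"]
        by (metis of_nat_le_iff of_nat_numeral of_nat_power zero_le)
    qed simp
    also have "(2 ^ k) ^ CARD('n) * L powr d = q ^ k * (1 / (1 - r)) powr d"
    proof -
      have "L powr d = (r ^ k) powr d * (1 / (1 - r)) powr d"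
        unfolding L_def using r powr_mult[of "r ^ k" "1 / (1 - r)" d] by simp
      also have "(r ^ k) powr d = (r powr d) ^ k"
        using r by (simp add: powr_powr mult.commute flip: powr_realpow)
      finally show ?thesis
        by (simp add: q_def power_mult_distrib mult.commute flip: power_mult)
    qed
    finally show ?thesis .
  qed
  moreover have "(\<lambda>k. ennreal (q ^ k * (1 / (1 - r)) powr d)) \<longlonglongrightarrow> ennreal (0 * (1 / (1 - r)) powr d)"
    using small by (intro tendsto_ennrealI tendsto_mult LIMSEQ_power_zero tendsto_const) (simp add: q_def)
  ultimately have "hcontent d (cantor_product r :: (real ^ 'n) set) \<le> ennreal (0 * (1 / (1 - r)) powr d)"
    by (intro LIMSEQ_le_const) auto
  then show ?thesis by simp
qed

text \<open>Any covering is pulled back to the parameters in \<open>cube 0 (1/2)\<close>: those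
  landing in a cube of edge \<open>l\<close> fit into a cube of volume \<open>K * l powr d\<close>.
  The total cost is hence at least \<open>(1/2) ^ CARD('n) / K\<close>.\<close>

lemma hcontent_cantor_product_pos:
  assumes r: "0 < r" "r < 1/2" and d: "0 < d" and large: "1 \<le> 2 ^ CARD('n) * r powr d"
  shows "hcontent d (cantor_product r :: (real ^ 'n) set) \<noteq> 0"
proof -
  \<comment> \<open>With this exponent the \<open>CARD('n)\<close>-th power of
    \<open>l powr \<gamma>\<close> is \<open>l powr d\<close>, which turns volume into cost. The
    assumption \<open>large\<close> is then the Hoelder condition
    \<open>1/2 \<le> r powr \<gamma>\<close> after taking roots.\<close>
  define \<gamma> where "\<gamma> = d / CARD('n)"
  define B where "B = (1 - r) / (1 - 2 * r)"
  have B: "0 < B" using r by (simp add: B_def)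
  have \<gamma>: "0 \<le> \<gamma>" using d by (simp add: \<gamma>_def)
  have half: "1/2 \<le> r powr \<gamma>"
  proof -
    have "(1/2) ^ CARD('n) \<le> (r powr \<gamma>) ^ CARD('n)"
      using large r by (simp add: \<gamma>_def powr_powr field_simps power_divide flip: powr_realpow)
    then show ?thesis
      by (rule power_mono_iff[THEN iffD1, rotated -1]) auto
  qed
  define K where "K = 2 ^ CARD('n) * B powr d"
  have K: "0 < K" using B by (simp add: K_def)
  have "ennreal ((1/2) ^ CARD('n)) \<le> ennreal K * (\<integral>\<^sup>+ (a, l). ennreal (l powr d) \<partial>count_space C)"
    if C: "countable C" "C \<subseteq> UNIV \<times> {0<..}" "cantor_product r \<subseteq> (\<Union>(a, l)\<in>C. cube a l)"
    for C :: "((real ^ 'n) \<times> real) set"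
  proof -
    \<comment> \<open>Edge 1/2 keeps the closed parameter cube inside \<open>[0,1)\<close> in each
      coordinate, where all floors are 0.\<close>
    define T where "T a l = {t \<in> cube 0 (1/2). (\<chi> i. spread r (t $ i)) \<in> cube a l}"
      for a :: "real ^ 'n" and l
    \<comment> \<open>Any point \<open>s\<close> of \<open>T a l\<close> can serve as the centre, by
      the Hoelder bound in each coordinate. The enclosing cubes are Borel and have known volume, so
      they replace \<open>T a l\<close> in the measure estimate.\<close>
    have "\<exists>b. T a l \<subseteq> cube b (2 * (B * l) powr \<gamma>)" for a l
    proof (cases "T a l = {}")
      case False
      then obtain s where s: "s \<in> T a l" by blast
      have "T a l \<subseteq> cube (\<chi> i. s $ i - (B * l) powr \<gamma>) (2 * (B * l) powr \<gamma>)"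
      proof
        fix t assume t: "t \<in> T a l"
        have "\<bar>t $ i - s $ i\<bar> \<le> (B * l) powr \<gamma>" for i
        proof -
          have "0 \<le> t $ i" "t $ i \<le> 1/2" "0 \<le> s $ i" "s $ i \<le> 1/2"
            using s t by (simp_all add: T_def mem_cube)
          then have "\<lfloor>t $ i\<rfloor> = \<lfloor>s $ i\<rfloor>" by (simp add: floor_unique[of 0])
          then have "\<bar>t $ i - s $ i\<bar> \<le> (B * \<bar>spread r (t $ i) - spread r (s $ i)\<bar>) powr \<gamma>"
            unfolding B_def using r \<gamma> half by (intro spread_inverse_holder)
          also have "\<dots> \<le> (B * l) powr \<gamma>"
          proof (intro powr_mono2 mult_left_mono)
            show "\<bar>spread r (t $ i) - spread r (s $ i)\<bar> \<le> l"
              using s t by (simp add: T_def mem_cube) (smt (verit))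
          qed (use B \<gamma> in auto)
          finally show ?thesis .
        qed
        then show "t \<in> cube (\<chi> i. s $ i - (B * l) powr \<gamma>) (2 * (B * l) powr \<gamma>)"
          unfolding mem_cube by (simp add: abs_le_iff algebra_simps)
      qed
      then show ?thesis by blast
    qed simp
    then obtain b where b: "\<And>a l. T a l \<subseteq> cube (b a l) (2 * (B * l) powr \<gamma>)"
      by metis
    have "cube 0 (1/2) \<subseteq> (\<Union>(a, l)\<in>C. cube (b a l) (2 * (B * l) powr \<gamma>))"
    proof
      fix t :: "real ^ 'n" assume t: "t \<in> cube 0 (1/2)"
      then have "0 \<le> t $ i" "t $ i \<le> 1/2" for i
        by (simp_all add: mem_cube)
      then have "t $ i \<in> {0..<1}" for i
        by (simp add: le_less_trans[of _ "1/2"])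
      then have "(\<chi> i. spread r (t $ i)) \<in> cantor_product r"
        by (auto simp: cantor_product_def)
      then obtain a l where "(a, l) \<in> C" "t \<in> T a l"
        using C(3) t by (auto simp: T_def)
      then show "t \<in> (\<Union>(a, l)\<in>C. cube (b a l) (2 * (B * l) powr \<gamma>))"
        using b by blast
    qed
    then have "emeasure lborel (cube (0 :: real ^ 'n) (1/2))
        \<le> emeasure lborel (\<Union>(a, l)\<in>C. cube (b a l) (2 * (B * l) powr \<gamma>))"
      using C(1) by (intro emeasure_mono) (auto intro!: sets.countable_UN')
    also have "\<dots> \<le> (\<integral>\<^sup>+ x. emeasure lborel (case x of (a, l) \<Rightarrow> cube (b a l) (2 * (B * l) powr \<gamma>)) \<partial>count_space C)"
      using C(1) by (intro emeasure_UN_le_nn_integral) auto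
    also have "\<dots> = (\<integral>\<^sup>+ x. ennreal K * (case x of (a, l) \<Rightarrow> ennreal (l powr d)) \<partial>count_space C)"
    proof (rule nn_integral_cong)
      fix x assume "x \<in> space (count_space C)"
      then obtain a l where x: "x = (a, l)" and l: "0 < l" using C(2) by auto
      have "(2 * (B * l) powr \<gamma>) ^ CARD('n) = 2 ^ CARD('n) * ((B * l) powr \<gamma>) ^ CARD('n)"
        by (rule power_mult_distrib)
      also have "((B * l) powr \<gamma>) ^ CARD('n) = (B * l) powr d"
        using B l by (simp add: \<gamma>_def powr_powr flip: powr_realpow)
      finally have "(2 * (B * l) powr \<gamma>) ^ CARD('n) = K * l powr d"
        using B l by (simp add: K_def powr_mult)
      then show "emeasure lborel (case x of (a, l) \<Rightarrow> cube (b a l) (2 * (B * l) powr \<gamma>))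
          = ennreal K * (case x of (a, l) \<Rightarrow> ennreal (l powr d))"
        using K by (simp add: x emeasure_cube ennreal_mult)
    qed
    also have "\<dots> = ennreal K * (\<integral>\<^sup>+ (a, l). ennreal (l powr d) \<partial>count_space C)"
      by (intro nn_integral_cmult) simp
    finally show ?thesis by (simp add: emeasure_cube)
  qed
  then have "ennreal ((1/2) ^ CARD('n)) / ennreal K \<le> hcontent d (cantor_product r :: (real ^ 'n) set)"
    unfolding hcontent_def using K
    by (intro INF_greatest) (auto simp: divide_le_posI_ennreal mult.commute)
  moreover have "0 < ennreal ((1/2) ^ CARD('n)) / ennreal K"
    using K by (simp add: divide_ennreal)
  ultimately show ?thesis by auto
qed

section \<open>Choquet integrals and averages of functions bounded by 1 off a null set\<close>

lemma choquet_le_hcontent: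
  assumes null: "hcontent d E = 0" and f: "\<And>x. x \<notin> E \<Longrightarrow> f x \<le> 1"
  shows "choquet d K f \<le> hcontent d K"
proof -
  \<comment> \<open>For \<open>t > 1\<close> the superlevel set lies in the null set
    \<open>E\<close>, even where \<open>f\<close> is infinite; for the remaining levels it lies in
    \<open>K\<close>. Only an interval of length 1 contributes.\<close>
  have "choquet d K f \<le> (\<integral>\<^sup>+ t. hcontent d K * indicator {0..1::real} t \<partial>lborel)"
    unfolding choquet_def
  proof (intro nn_integral_mono)
    fix t :: real
    show "hcontent d {x \<in> K. f x > ennreal t} * indicator {0..} t \<le> hcontent d K * indicator {0..1} t"
    proof (cases "t \<le> 1")
      case True
      then show ?thesis
        using hcontent_mono[of "{x \<in> K. f x > ennreal t}" K d] by (auto simp: indicator_def)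
    next
      case False
      have "{x \<in> K. f x > ennreal t} \<subseteq> E"
      proof
        fix x assume "x \<in> {x \<in> K. f x > ennreal t}"
        then have "ennreal t < f x" by simp
        moreover have "1 \<le> ennreal t" using False by simp
        ultimately have "1 < f x" by (rule le_less_trans[rotated])
        then have "\<not> f x \<le> 1" by simp
        then show "x \<in> E" using f by blast
      qed
      then show ?thesis
        using hcontent_mono[of _ E d] null by (simp add: le_zero_eq)
    qed
  qed
  also have "\<dots> = hcontent d K"
    by (simp add: nn_integral_cmult_indicator)
  finally show ?thesis .
qed

lemma cube_average_le_one:
  assumes "hcontent d E = 0" "\<And>x. x \<notin> E \<Longrightarrow> f x \<le> 1"
  shows "cube_average d a l f \<le> 1"
proof -
  let ?h = "hcontent d (cube a l)"
  have "cube_average d a l f \<le> 1 / ?h * ?h"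
    unfolding cube_average_def
    using choquet_le_hcontent[of d E f "cube a l"] assms by (intro mult_left_mono) auto
  also have "\<dots> \<le> 1"
    \<comment> \<open>At \<open>?h = 0\<close> and \<open>?h = top\<close> the product is 0 by the
      \<open>ennreal\<close> conventions; otherwise it is 1.\<close>
    by (cases "?h = 0 \<or> ?h = top") (auto simp: ennreal_times_divide mult.commute less_top)
  finally show ?thesis .
qed

lemma ennpowr_le_one: "x \<le> 1 \<Longrightarrow> 0 < s \<Longrightarrow> ennpowr x s \<le> 1"
  using enn2real_mono[of x 1] powr_mono2[of s "enn2real x" 1]
  by (auto simp: ennpowr_def top_unique)

section \<open>The weight and its Muckenhoupt constants\<close>

theorem theorem1p1:
  fixes \<delta> p :: real
  assumes "0 < \<delta>" and "\<delta> \<le> real CARD('n::finite)" and "1 \<le> p"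
  shows "\<exists>w :: real ^ 'n \<Rightarrow> ennreal.
           capacity_weight \<delta> w \<and> w \<in> muckenhoupt p \<delta> \<and>
           (\<forall>\<beta>. 0 < \<beta> \<and> \<beta> < \<delta> \<longrightarrow> w \<notin> muckenhoupt p \<beta>)"
proof -
  \<comment> \<open>Solves \<open>2 ^ CARD('n) * r m powr d = 1\<close> for
    \<open>d = \<delta> / (1 + 1 / (real m + 1))\<close>, a dimension below \<delta> that increases
    to \<delta> with \<open>m\<close>.\<close>
  define r where "r m = 2 powr (- real CARD('n) * (1 + 1 / (real m + 1)) / \<delta>)" for m :: nat
  have two: "2 ^ CARD('n) * r m powr d = 2 powr (real CARD('n) * (1 - (1 + 1 / (real m + 1)) * d / \<delta>))"
    for m d
  proof -
    define c where "c = 1 + 1 / (real m + 1)"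
    have "real CARD('n) + (- real CARD('n) * c / \<delta>) * d = real CARD('n) * (1 - c * d / \<delta>)"
      by (simp add: right_diff_distrib)
    then show ?thesis
      unfolding r_def c_def[symmetric] by (simp add: powr_powr flip: powr_realpow powr_add)
  qed
  \<comment> \<open>Since \<delta> is at most the dimension of the space, the exponent of 2 is
    strictly below -1.\<close>
  have r: "0 < r m" "r m < 1/2" for m
  proof -
    have "1 \<le> real CARD('n) / \<delta>" using assms by simp
    then have "1 * 1 < real CARD('n) / \<delta> * (1 + 1 / (real m + 1))"
      by (intro mult_le_less_imp_less) auto
    then have "r m < 2 powr (- 1)" unfolding r_def by (intro powr_less_mono) auto
    then show "r m < 1/2" by (simp add: powr_minus_divide)
  qed (simp add: r_def)
  define E :: "(real ^ 'n) set" where "E = (\<Union>m. cantor_product (r m))"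
  have null: "hcontent \<delta> E = 0"
    unfolding E_def
  proof (intro hcontent_null_UN hcontent_cantor_product_null r)
    fix m :: nat
    show "r m < 1" using r(2)[of m] by simp
    \<comment> \<open>At \<open>d = \<delta>\<close> the exponent is
      \<open>- real CARD('n) / (real m + 1)\<close>, negative for every \<open>m\<close>.\<close>
    have "2 powr (real CARD('n) * (1 - (1 + 1 / (real m + 1)) * \<delta> / \<delta>)) < 2 powr 0"
      using assms by (intro powr_less_mono) (auto simp: mult_less_0_iff)
    then show "2 ^ CARD('n) * r m powr \<delta> < 1" unfolding two by simp
  qed
  have pos: "hcontent \<beta> E \<noteq> 0" if \<beta>: "0 < \<beta>" "\<beta> < \<delta>" for \<beta>
  proof -
    \<comment> \<open>Picks a Cantor product of dimension at least \<beta>.\<close>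
    obtain m where "1 / (real m + 1) < \<delta> / \<beta> - 1"
      using reals_Archimedean[of "\<delta> / \<beta> - 1"] \<beta> by (auto simp: inverse_eq_divide add.commute)
    then have "1 + 1 / (real m + 1) \<le> \<delta> / \<beta>" by simp
    then have "(1 + 1 / (real m + 1)) * \<beta> / \<delta> \<le> 1"
      using \<beta> by (simp add: le_divide_eq divide_le_eq)
    then have "2 powr 0 \<le> 2 ^ CARD('n) * r m powr \<beta>"
      unfolding two by (intro powr_mono mult_nonneg_nonneg) auto
    then have "hcontent \<beta> (cantor_product (r m) :: (real ^ 'n) set) \<noteq> 0"
      using r \<beta> by (intro hcontent_cantor_product_pos) auto
    moreover have "hcontent \<beta> (cantor_product (r m) :: (real ^ 'n) set) \<le> hcontent \<beta> E"
      unfolding E_def by (intro hcontent_mono) auto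
    ultimately show ?thesis by auto
  qed
  \<comment> \<open>The value infinity on \<open>E\<close> makes the \<open>A_1\<close> inequality
    with constant 1 hold at every point, so its exceptional set is empty.\<close>
  define w :: "real ^ 'n \<Rightarrow> ennreal" where "w x = (if x \<in> E then \<infinity> else 1)" for x
  have bad: "{x. \<not> (0 < w x \<and> w x < \<infinity>)} = E" by (auto simp: w_def)
  have "w \<in> L1_loc \<delta>"
    unfolding L1_loc_def
  proof safe
    fix K :: "(real ^ 'n) set" assume "compact K"
    then show "choquet \<delta> K w < \<infinity>"
      using choquet_le_hcontent[OF null, of w K] hcontent_compact_finite[of K \<delta>]
      by (simp add: w_def order_le_less_trans)
  qed
  then have weight: "capacity_weight \<delta> w"
    using null by (simp add: capacity_weight_def hcontent_ae_def bad[simplified])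
  have avg: "cube_average \<delta> a l w \<le> 1" for a l
    by (rule cube_average_le_one[OF null]) (simp add: w_def)
  have "Ap_const p \<delta> w \<le> 1"
  proof (cases "p = 1")
    case True
    have "maximal_op \<delta> w x \<le> ennreal 1 * w x" for x
    proof -
      have "maximal_op \<delta> w x \<le> 1"
        unfolding maximal_op_def using avg by (intro SUP_least) auto
      also have "1 \<le> w x" by (simp add: w_def)
      finally show ?thesis by simp
    qed
    moreover have "hcontent \<delta> ({} :: (real ^ 'n) set) = 0"
      using hcontent_mono[of "{}" E \<delta>] null by simp
    ultimately have "A1_const \<delta> w \<le> ennreal 1"
      unfolding A1_const_def hcontent_ae_def by (intro Inf_lower) (auto intro!: exI[of _ 1])
    then show ?thesis using True by (simp add: Ap_const_def)
  next
    case False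
    have "cube_average \<delta> a l w * ennpowr (cube_average \<delta> a l (\<lambda>x. ennpowr (w x) (- 1 / (p - 1)))) (p - 1)
        \<le> 1 * 1" for a l
    proof (intro mult_mono avg ennpowr_le_one)
      \<comment> \<open>The dual weight is 1 off \<open>E\<close> and 0 on it, since infinity to a
        negative power is 0.\<close>
      show "cube_average \<delta> a l (\<lambda>x. ennpowr (w x) (- 1 / (p - 1))) \<le> 1"
        by (rule cube_average_le_one[OF null]) (simp add: w_def ennpowr_def)
    qed (use False assms in auto)
    then show ?thesis
      using False by (auto simp: Ap_const_def intro!: SUP_least)
  qed
  then have "w \<in> muckenhoupt p \<delta>"
    using weight by (auto simp: muckenhoupt_def intro: order_le_less_trans)
  \<comment> \<open>Already the capacity weight condition fails: \<open>w\<close> is infinite on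
    \<open>E\<close>, which has positive content in dimension \<beta>.\<close>
  moreover have "w \<notin> muckenhoupt p \<beta>" if "0 < \<beta> \<and> \<beta> < \<delta>" for \<beta>
    using pos that by (simp add: muckenhoupt_def capacity_weight_def hcontent_ae_def bad[simplified])
  ultimately show ?thesis using weight by blast
qed

end
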